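(* Consider the cut-posterior setting of the context. Assume that for all sequences $z_n\to\infty$ there exist $\mathcal T_n\subset\mathcal T$ with $\vartheta^*\in\mathcal T_n$, $\epsilon_n=o(1)$ and a non-negative random function $\phi_n=\phi_n(\cdot|Y_{1:n})$ on $\mathcal T_n$ with $\mathrm{supp}(\phi_n)\subset\mathcal T_n$, such that $$\|\pi_1(\cdot|Y_{1:n})-\phi_n(\cdot|Y_{1:n})\|_{L^1(\mu)}=o_{\mathbb P^n_*}(1),\qquad \mu(\mathcal T_n)\,\mathbb E^n_*\Big(\int_{\mathcal T_n}\phi_n^2(\vartheta)\,d\mu(\vartheta)\Big)=O(z_n),$$ $$\exists K>0\ \text{ s.t. }\ \mathbb P^n_*\Big[\sup_{\vartheta\in\mathcal T_n}\phi_n(\vartheta)>e^{Kn\epsilon_n^2}\Big]=o(1),$$ and let this hold with $n\epsilon_n^2\to\infty$. Assume that there exists $C>0$ such that for any $\vartheta\in\mathcal T_n$ there are sets $S_n(\vartheta)\subset\mathcal F_2$ satisfying $$\bigcup_{\vartheta\in\mathcal T_n}\{\vartheta\}\times S_n(\vartheta)\subset V_n(\mathbb P^n_*,\epsilon_n),\qquad \inf_{\vartheta\in\mathcal T_n}\Pi_2(S_n(\vartheta)|\vartheta)\ge e^{-Cn\epsilon_n^2}.$$ Assume also that there exist $L_n\to\infty$, $\mathcal F_{2,n}(\vartheta)\subset\mathcal F_2$ and $\psi_n:\mathcal Y^n\to\{0,1\}$ such that $$\sup_{\vartheta\in\mathcal T_n}\Pi_2(\mathcal F_{2,n}(\vartheta)^c|\vartheta)\le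 e^{-L_nn\epsilon_n^2}$$ and, setting $\mathcal U_n=\bigcup_{\vartheta\in\mathcal T_n}\{\vartheta\}\times\mathcal F_{2,n}(\vartheta)$, $$\mathbb E_*^n\psi_n=o(1),\qquad \sup_{\substack{(\vartheta,\eta)\in\mathcal U_n\\ d(\mathbb P^\ell_{\vartheta,\eta},\mathbb P^\ell_{\vartheta^*,\eta^*})>K_n\epsilon_n}}\mathbb E^n_{\vartheta,\eta}(1-\psi_n)\le C'e^{-2L_nn\epsilon_n^2}$$ for some $K_n>0$ and some constant $C'>0$. Then, as $n\to\infty$, $$\Pi_{cut}\big(B_\ell^c(K_n\epsilon_n)\,\big|\,Y_{1:n}\big)=o_{\mathbb P_*^n}(1).$$
   Context: **Setting.** $Y_{1:n}\in\mathcal Y^n$ has law $\mathbb P^n_{\vartheta,\eta}$ depending on a finite-dimensional parameter $\vartheta$ and an infinite-dimensional parameter $\eta$. For some fixed $\ell>0$, $\mathbb P^\ell_{\vartheta,\eta}$ is the law of $\ell$ observations. The data are generated by $\mathbb P^n_*=\mathbb P^n_{\vartheta^*,\eta^*}$; $\mathbb E^n_*$, $\mathbb E^n_{\vartheta,\eta}$ are the corresponding expectations. *Model 1*: a model $\mathcal T\times\mathcal F_1$ for $(\vartheta,\eta)$ with $\vartheta^*\in\mathcal T$ (but $\eta^*\in\mathcal F_1$ is not required) and a joint prior $\Pi_1$, giving the marginal posterior $\Pi_1(d\vartheta|Y_{1:n})=\int_{\mathcal F_1}\Pi_1(d\vartheta,d\eta|Y_{1:n})$, with density $\pi_1(\cdot|Y_{1:n})$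 with respect to some measure $\mu$ on $\mathcal T$. *Model 2*: a parameter set $\mathcal F_2\ni\eta^*$ for $\eta$, with conditional prior $\Pi_2(\cdot|\vartheta)$, giving the conditional posterior $\Pi_2(d\eta|Y_{1:n},\vartheta)$. The *cut posterior* is $\Pi_{cut}(d\vartheta,d\eta|Y_{1:n})=\Pi_1(d\vartheta|Y_{1:n})\,\Pi_2(d\eta|\vartheta,Y_{1:n})$. For some loss function $d(\cdot,\cdot)$ on the laws $\mathbb P^\ell_{\vartheta,\eta}$, $B_\ell(\epsilon)=\{(\vartheta,\eta):d(\mathbb P^\ell_{\vartheta,\eta},\mathbb P^\ell_{\vartheta^*,\eta^*})<\epsilon\}$ and $B_\ell^c(\epsilon)$ is its complement. $V_n(\mathbb P^n_*,\epsilon)=\{(\vartheta,\eta):\mathcal K(\mathbb P^n_{\vartheta^*,\eta^*}|\mathbb P^n_{\vartheta,\eta})<n\epsilon^2\}$, with $\mathcal K(\mathbb P^n_{\vartheta^*,\eta^*}|\mathbb P^n_{\vartheta,\eta})=\mathbb E^n_*\log\frac{d\mathbb P^n_{\vartheta^*,\eta^*}}{d\mathbb P^n_{\vartheta,\eta}}$ the Kullback–Leibler divergence.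
   Formalization: The claim can fail on {d = K_n ε_n}, which the tests do not control; proved instead: the cut posterior mass of {d > K_n ε_n} is o_P(1), and that of B_ℓ^c(K_n ε_n) is o_P(1) if the test bound also covers d = K_n ε_n. The measure μ is taken σ-finite. *)

theory Defs
  imports "HOL-Probability.Probability"
begin

definition obs :: "'y measure \<Rightarrow> nat \<Rightarrow> (nat \<Rightarrow> 'y) measure" where
  "obs Y n = PiM {1..n} (\<lambda>_. Y)"

text \<open>The library constant \<^const>\<open>KL_divergence\<close> takes the arguments in the order (reference
  measure, law) and is a real-valued Bochner integral, so it has a junk value when the divergence
  is infinite. For probability measures with \<open>P\<close> absolutely continuous with respect to \<open>Q\<close> the
  negative part of the log-density ratio is always \<open>P\<close>-integrable, hence non-integrability
  means that the divergence is infinite.\<close>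

definition KL_div :: "'b measure \<Rightarrow> 'b measure \<Rightarrow> ereal" where
  "KL_div P Q =
     (if absolutely_continuous Q P \<and> integrable P (entropy_density (exp 1) Q P)
      then ereal (KL_divergence (exp 1) Q P) else \<infinity>)"

definition KL_nbhd :: "('t \<Rightarrow> 'e \<Rightarrow> 'b measure) \<Rightarrow> 't \<Rightarrow> 'e \<Rightarrow> nat \<Rightarrow> real \<Rightarrow> ('t \<times> 'e) set" where
  "KL_nbhd Pn \<theta>0 \<eta>0 n \<epsilon> =
     {(\<theta>, \<eta>). KL_div (Pn \<theta>0 \<eta>0) (Pn \<theta> \<eta>) < ereal (real n * \<epsilon>\<^sup>2)}"

definition loss_ball ::
  "('m \<Rightarrow> 'm \<Rightarrow> ennreal) \<Rightarrow> ('t \<Rightarrow> 'e \<Rightarrow> 'm) \<Rightarrow> 't \<Rightarrow> 'e \<Rightarrow> real \<Rightarrow> ('t \<times> 'e) set" where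
  "loss_ball d Pl \<theta>0 \<eta>0 \<epsilon> = {(\<theta>, \<eta>). d (Pl \<theta> \<eta>) (Pl \<theta>0 \<eta>0) < ennreal \<epsilon>}"

text \<open>\<open>\<kappa>\<close> is a posterior for the prior \<open>p\<close> and the sampling kernel \<open>P\<close>: a regular conditional
  distribution of the parameter given the observation under the joint law
  \<open>p(d\<theta>) P \<theta> (dy)\<close>, whose marginal law of the observation is \<open>p \<bind> P\<close>. In a dominated model
  this is Bayes' formula.\<close>

definition is_posterior ::
  "'t measure \<Rightarrow> ('t \<Rightarrow> 'b measure) \<Rightarrow> 'b measure \<Rightarrow> ('b \<Rightarrow> 't measure) \<Rightarrow> bool" where
  "is_posterior p P M \<kappa> \<longleftrightarrow>
     \<kappa> \<in> M \<rightarrow>\<^sub>M prob_algebra p \<and>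
     (\<forall>A\<in>sets p. \<forall>B\<in>sets M.
        (\<integral>\<^sup>+\<theta>\<in>A. emeasure (P \<theta>) B \<partial>p) = (\<integral>\<^sup>+y\<in>B. emeasure (\<kappa> y) A \<partial>(p \<bind> P)))"

text \<open>\<open>\<Pi>1(d\<theta>) \<Pi>2(d\<eta> | \<theta>)\<close> as a measure on the product of the two parameter spaces.\<close>

definition cut_joint ::
  "'t measure \<Rightarrow> 'e measure \<Rightarrow> 't measure \<Rightarrow> ('t \<Rightarrow> 'e measure) \<Rightarrow> ('t \<times> 'e) measure" where
  "cut_joint \<Theta> F \<Pi>1 \<Pi>2 = \<Pi>1 \<bind> (\<lambda>\<theta>. distr (\<Pi>2 \<theta>) (\<Theta> \<Otimes>\<^sub>M F) (\<lambda>\<eta>. (\<theta>, \<eta>)))"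

text \<open>Outer measure is used because the events below involve suprema over uncountable sets, which
  need not be measurable; on measurable events it is the probability itself.\<close>

definition prob_vanishes :: "(nat \<Rightarrow> 'b measure) \<Rightarrow> (nat \<Rightarrow> 'b \<Rightarrow> bool) \<Rightarrow> bool" where
  "prob_vanishes Q E \<longleftrightarrow>
     (\<lambda>n. outer_measure_of (Q n) {y \<in> space (Q n). E n y}) \<longlonglongrightarrow> 0"

definition small_op :: "(nat \<Rightarrow> 'b measure) \<Rightarrow> (nat \<Rightarrow> 'b \<Rightarrow> ennreal) \<Rightarrow> bool" where
  "small_op Q X \<longleftrightarrow> (\<forall>\<delta>::real. \<delta> > 0 \<longrightarrow> prob_vanishes Q (\<lambda>n y. X n y > ennreal \<delta>))"

text \<open>The requirements on \<open>(T\<^sub>n, \<epsilon>\<^sub>n, \<phi>\<^sub>n)\<close> for a given sequence \<open>z\<^sub>n\<close>. Here \<open>M n\<close> is the sample space of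
  \<open>n\<close> observations and \<open>Q n\<close> their true law, and \<open>\<pi> n y\<close> is the marginal posterior density.
  Conditions at a fixed sample size are imposed for \<open>n \<ge> 1\<close> only.\<close>

definition posterior_approx ::
  "(nat \<Rightarrow> 'b measure) \<Rightarrow> (nat \<Rightarrow> 'b measure) \<Rightarrow> 't measure \<Rightarrow> 't \<Rightarrow> (nat \<Rightarrow> 'b \<Rightarrow> 't \<Rightarrow> real) \<Rightarrow>
   (nat \<Rightarrow> real) \<Rightarrow> (nat \<Rightarrow> 't set) \<Rightarrow> (nat \<Rightarrow> real) \<Rightarrow> (nat \<Rightarrow> 'b \<Rightarrow> 't \<Rightarrow> real) \<Rightarrow> bool" where
  "posterior_approx M Q \<mu> \<theta>0 \<pi> z T \<epsilon> \<phi> \<longleftrightarrow>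
     (\<forall>n\<ge>1. T n \<in> sets \<mu> \<and> \<theta>0 \<in> T n) \<and>
     (\<forall>n\<ge>1. \<epsilon> n > 0) \<and> \<epsilon> \<longlonglongrightarrow> 0 \<and>
     filterlim (\<lambda>n. real n * (\<epsilon> n)\<^sup>2) at_top sequentially \<and>
     (\<forall>n\<ge>1. (\<lambda>(y, \<theta>). \<phi> n y \<theta>) \<in> borel_measurable (M n \<Otimes>\<^sub>M \<mu>) \<and>
        (\<forall>y\<in>space (M n). \<forall>\<theta>\<in>space \<mu>. \<phi> n y \<theta> \<ge> 0 \<and> (\<theta> \<notin> T n \<longrightarrow> \<phi> n y \<theta> = 0))) \<and>
     small_op Q (\<lambda>n y. \<integral>\<^sup>+\<theta>. ennreal \<bar>\<pi> n y \<theta> - \<phi> n y \<theta>\<bar> \<partial>\<mu>) \<and>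
     (\<exists>c::real. c > 0 \<and> (\<forall>\<^sub>F n in sequentially.
        emeasure \<mu> (T n) * (\<integral>\<^sup>+y. (\<integral>\<^sup>+\<theta>\<in>T n. ennreal ((\<phi> n y \<theta>)\<^sup>2) \<partial>\<mu>) \<partial>Q n)
          \<le> ennreal (c * z n))) \<and>
     (\<exists>K::real. K > 0 \<and> prob_vanishes Q (\<lambda>n y.
        (SUP \<theta>\<in>T n. ennreal (\<phi> n y \<theta>)) > ennreal (exp (K * real n * (\<epsilon> n)\<^sup>2))))"

end

theory Submission
  imports Defs
begin

text \<open>Let \<open>g(\<theta>, y) = (1 - \<psi>\<^sub>n(y)) \<Pi>2(A\<^sub>\<theta> | \<theta>, y)\<close>, where \<open>A\<^sub>\<theta>\<close> is the set of \<open>\<eta>\<close> with large loss. Instead of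
  bounding the evidence from below by Bayes' formula, use the entropy inequality
  \<open>\<tau> E\<^sub>*g \<le> K(P\<^sub>* | P\<^bsub>\<theta>,\<eta>\<^esub>) + e\<^sup>\<tau> E\<^bsub>\<theta>,\<eta>\<^esub> g\<close>, valid for \<open>0 \<le> g \<le> 1\<close>, and average it over \<open>\<eta> \<in> S\<^sub>n(\<theta>)\<close>.
  Under the prior predictive law, the expectation of \<open>g\<close> is the integral of
  \<open>E\<^bsub>\<theta>,\<eta>\<^esub>(1 - \<psi>\<^sub>n)\<close> over \<open>A\<^sub>\<theta>\<close>, which the tests and the sieve bound by a multiple of
  \<open>exp(-L\<^sub>n n \<epsilon>\<^sub>n\<^sup>2)\<close>; the choice \<open>\<tau> = L\<^sub>n n \<epsilon>\<^sub>n\<^sup>2 / 2\<close> gives \<open>E\<^sub>*g = O(1 / L\<^sub>n)\<close> uniformly in \<open>\<theta> \<in> T\<^sub>n\<close>.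

  It remains to integrate against the marginal posterior. As \<open>L\<^sub>n\<close> may grow more slowly than \<open>z\<^sub>n\<close>,
  take a second approximation \<open>(T'\<^sub>n, \<phi>'\<^sub>n)\<close> belonging to the sequence \<open>\<surd>L\<^sub>n\<close>. The posterior density is
  close in \<open>L\<^sup>1\<close> to \<open>\<phi>'\<^sub>n\<close> restricted to \<open>T\<^sub>n \<inter> T'\<^sub>n\<close>, and by Cauchy-Schwarz the integral of
  \<open>\<phi>'\<^sub>n g\<close> over this set has expectation \<open>O((\<surd>L\<^sub>n / L\<^sub>n)\<^bsup>1/2\<^esup>) = o(1)\<close>.\<close>

text \<open>Convexity: the chord of \<open>exp\<close> over the segment from 0 to
  \<open>\<tau>\<close> gives \<open>1 - t + t * exp \<tau>\<close>, and the term \<open>- t\<close>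
  is dropped. This linearises \<open>exp (\<tau> * f)\<close> in \<open>f\<close> for the entropy
  inequality.\<close>

lemma exp_scaled_le:
  fixes \<tau> t :: real
  assumes "0 \<le> t" "t \<le> 1"
  shows "exp (\<tau> * t) \<le> 1 + exp \<tau> * t"
proof -
  have "exp ((1 - t) *\<^sub>R 0 + t *\<^sub>R \<tau>) \<le> (1 - t) * exp 0 + t * exp \<tau>"
    using assms by (intro convex_onD[OF exp_convex]) auto
  with assms show ?thesis by (simp add: algebra_simps)
qed

text \<open>Young's inequality for the convex conjugates \<open>p * ln p - p\<close> and
  \<open>exp x\<close>. It comes from \<open>ln u \<le> u - 1\<close> at
  \<open>u = exp x / p\<close>; at \<open>p = 0\<close> it is positivity of
  \<open>exp\<close>.\<close>

lemma mult_le_entropy_plus_exp: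
  fixes p x :: real
  assumes "0 \<le> p"
  shows "p * x \<le> p * ln p - p + exp x"
proof (cases "p = 0")
  case False
  with assms have p: "p > 0" by simp
  have "ln (exp x / p) \<le> exp x / p - 1"
    using p by (intro ln_le_minus_one) auto
  with p have "x - ln p \<le> exp x / p - 1" by (simp add: ln_div)
  then have "p * (x - ln p) \<le> p * (exp x / p - 1)" using p by simp
  with p show ?thesis by (simp add: algebra_simps)
qed auto

text \<open>Change of measure at the cost of the divergence. With \<open>p\<close> the density of
  \<open>P\<close> with respect to \<open>Q\<close>, Young's inequality is applied pointwise to
  \<open>p x\<close> and \<open>\<tau> * f x\<close>, and \<open>exp (\<tau> * f x)\<close> is then
  linearised. After integration against \<open>Q\<close> the term \<open>- p\<close> cancels the
  constant 1. It is the Donsker-Varadhan bound with the logarithm weakened by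
  \<open>ln u \<le> u - 1\<close>.\<close>

lemma expectation_le_KL:
  fixes f :: "'b \<Rightarrow> real"
  assumes P: "prob_space P" and Q: "prob_space Q" and sets: "sets P = sets Q"
    and KL: "KL_div P Q \<le> ereal r"
    and f: "f \<in> borel_measurable Q" "\<And>x. x \<in> space Q \<Longrightarrow> 0 \<le> f x" "\<And>x. x \<in> space Q \<Longrightarrow> f x \<le> 1"
  shows "\<tau> * (\<integral>x. f x \<partial>P) \<le> r + exp \<tau> * (\<integral>x. f x \<partial>Q)"
proof -
  interpret P: prob_space P by fact
  interpret Q: prob_space Q by fact
  note [measurable] = f(1)
  \<comment> \<open>A real upper bound excludes the infinite branch of \<open>KL_div\<close>, so
    absolute continuity and integrability of the log-density come with it.\<close>
  have ac: "absolutely_continuous Q P" and int: "integrable P (entropy_density (exp 1) Q P)"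
    and r: "KL_divergence (exp 1) Q P \<le> r"
    using KL by (auto simp: KL_div_def split: if_splits)
  define p where "p = (\<lambda>x. enn2real (RN_deriv Q P x))"
  have [measurable]: "p \<in> borel_measurable Q" unfolding p_def by simp
  have p0: "0 \<le> p x" for x by (simp add: p_def)
  have ed: "entropy_density (exp 1) Q P = (\<lambda>x. ln (p x))"
    by (auto simp: entropy_density_def p_def log_def)
  note RN = Q.RN_deriv_integrable[OF P.sigma_finite_measure_axioms ac sets]
            Q.RN_deriv_integral[OF P.sigma_finite_measure_axioms ac sets]
  have [simp]: "space P = space Q" using sets by (rule sets_eq_imp_space_eq)
  have fQ: "integrable Q f"
    using f by (intro Q.integrable_const_bound[where B=1]) (auto intro!: AE_I2)
  have fP: "integrable P f"
    using f sets by (intro P.integrable_const_bound[where B=1]) (auto intro!: AE_I2 cong: measurable_cong_sets)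
  have i1: "integrable Q (\<lambda>x. p x * f x)" and e1: "(\<integral>x. f x \<partial>P) = (\<integral>x. p x * f x \<partial>Q)"
    using RN[of f] fP by (auto simp: p_def)
  have i2: "integrable Q (\<lambda>x. p x * ln (p x))" and e2: "(\<integral>x. p x * ln (p x) \<partial>Q) \<le> r"
    using RN[of "\<lambda>x. ln (p x)"] int r ed by (auto simp: p_def KL_divergence_def)
  have i3: "integrable Q p" and e3: "(\<integral>x. p x \<partial>Q) = 1"
    using RN[of "\<lambda>x. 1"] P.prob_space by (auto simp: p_def)
  have "\<tau> * (\<integral>x. f x \<partial>P) = (\<integral>x. \<tau> * (p x * f x) \<partial>Q)"
    by (simp add: e1)
  also have "\<dots> \<le> (\<integral>x. p x * ln (p x) - p x + (1 + exp \<tau> * f x) \<partial>Q)"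
  proof (rule integral_mono)
    fix x assume x: "x \<in> space Q"
    have "\<tau> * (p x * f x) = p x * (\<tau> * f x)" by simp
    also have "\<dots> \<le> p x * ln (p x) - p x + exp (\<tau> * f x)"
      by (rule mult_le_entropy_plus_exp[OF p0])
    also have "exp (\<tau> * f x) \<le> 1 + exp \<tau> * f x"
      using f x by (intro exp_scaled_le) auto
    finally show "\<tau> * (p x * f x) \<le> p x * ln (p x) - p x + (1 + exp \<tau> * f x)" by simp
  qed (use i1 i2 i3 fQ in auto)
  also have "\<dots> = (\<integral>x. p x * ln (p x) \<partial>Q) - 1 + (1 + exp \<tau> * (\<integral>x. f x \<partial>Q))"
    using i2 i3 fQ by (simp add: e3 Q.prob_space)
  also have "\<dots> \<le> r + exp \<tau> * (\<integral>x. f x \<partial>Q)" using e2 by simp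
  finally show ?thesis .
qed

text \<open>The entropy inequality is applied to the posterior mass of \<open>A\<close> on the event
  \<open>B\<close>, for each \<open>\<eta>\<close> in \<open>S\<close>, and averaged over
  \<open>S\<close> under the prior, which costs the factor \<open>1 / s\<close>. Averaging the
  expectations under \<open>P \<eta>\<close> over the whole prior gives an expectation under the
  marginal law \<open>p \<bind> P\<close>; there the posterior identity replaces posterior masses by
  the sampling probabilities of \<open>B\<close>, controlled by \<open>b\<close> on \<open>G\<close>
  and by \<open>a\<close> off \<open>G\<close>.\<close>

lemma posterior_expectation_le:
  assumes p: "prob_space p" and P: "P \<in> p \<rightarrow>\<^sub>M prob_algebra M" and post: "is_posterior p P M \<kappa>"
    and Q: "prob_space Q" "sets Q = sets M"
    and S: "S \<in> sets p" "\<And>\<eta>. \<eta> \<in> S \<Longrightarrow> KL_div Q (P \<eta>) \<le> ereal r"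
      "0 < s" "ennreal s \<le> emeasure p S"
    and A: "A \<in> sets p" and B: "B \<in> sets M" and G: "G \<in> sets p"
    and a: "emeasure p (space p - G) \<le> ennreal a" "0 \<le> a"
    and b: "\<And>\<eta>. \<eta> \<in> G \<inter> A \<Longrightarrow> emeasure (P \<eta>) B \<le> ennreal b" "0 \<le> b"
    and \<tau>: "0 < \<tau>"
  shows "(\<integral>\<^sup>+y\<in>B. emeasure (\<kappa> y) A \<partial>Q) \<le> ennreal ((r + exp \<tau> * (a + b) / s) / \<tau>)"
proof -
  interpret p: prob_space p by fact
  interpret Q: prob_space Q by fact
  have \<kappa>: "\<kappa> \<in> M \<rightarrow>\<^sub>M prob_algebra p"
    and post_eq: "(\<integral>\<^sup>+\<eta>\<in>A. emeasure (P \<eta>) B \<partial>p) = (\<integral>\<^sup>+y\<in>B. emeasure (\<kappa> y) A \<partial>(p \<bind> P))"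
    using post A B by (auto simp: is_posterior_def)
  note [measurable] = measurable_prob_algebraD[OF \<kappa>] measurable_prob_algebraD[OF P] S(1) A B G
  have P': "prob_space (P \<eta>)" "sets (P \<eta>) = sets M" if "\<eta> \<in> space p" for \<eta>
    using measurable_space[OF P that] by (auto simp: space_prob_algebra)
  have \<kappa>': "prob_space (\<kappa> y)" if "y \<in> space M" for y
    using measurable_space[OF \<kappa> that] by (auto simp: space_prob_algebra)
  \<comment> \<open>A real-valued form of the integrand, since the entropy inequality concerns
    Bochner integrals of functions between 0 and 1.\<close>
  define f where "f = (\<lambda>y. measure (\<kappa> y) A * indicator B y)"
  have f[measurable]: "f \<in> borel_measurable M" unfolding f_def by measurable
  have f01: "0 \<le> f y" "f y \<le> 1" if "y \<in> space M" for y
    using prob_space.prob_le_1[OF \<kappa>'[OF that]] by (auto simp: f_def indicator_def)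
  have fe: "ennreal (f y) = emeasure (\<kappa> y) A * indicator B y" if "y \<in> space M" for y
    using prob_space.finite_measure[OF \<kappa>'[OF that]] by (auto simp: f_def indicator_def finite_measure.emeasure_eq_measure)
  have spQ: "space Q = space M" using Q(2) by (rule sets_eq_imp_space_eq)
  have fQ: "integrable Q f"
    using f01 spQ Q(2) by (intro Q.integrable_const_bound[where B=1]) (auto intro!: AE_I2 cong: measurable_cong_sets)
  define x where "x = (\<integral>y. f y \<partial>Q)"
  have LHS: "(\<integral>\<^sup>+y\<in>B. emeasure (\<kappa> y) A \<partial>Q) = ennreal x"
  proof -
    have "(\<integral>\<^sup>+y\<in>B. emeasure (\<kappa> y) A \<partial>Q) = (\<integral>\<^sup>+y. ennreal (f y) \<partial>Q)"
      using fe spQ by (intro nn_integral_cong) auto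
    also have "\<dots> = ennreal x" unfolding x_def
      using fQ f01 spQ by (intro nn_integral_eq_integral) auto
    finally show ?thesis .
  qed
  define I where "I = (\<lambda>\<eta>. \<integral>\<^sup>+y. ennreal (f y) \<partial>P \<eta>)"
  have [measurable]: "I \<in> borel_measurable p"
    unfolding I_def by (rule nn_integral_measurable_subprob_algebra2[where N=M]) measurable
  \<comment> \<open>The cast to \<open>ennreal\<close> truncates: if \<open>\<tau> * x - r\<close>
    is negative, the left side is 0.\<close>
  have step: "ennreal (\<tau> * x - r) \<le> ennreal (exp \<tau>) * I \<eta>" if \<eta>: "\<eta> \<in> S" for \<eta>
  proof -
    have sp: "\<eta> \<in> space p" using \<eta> S(1) sets.sets_into_space by blast
    interpret R: prob_space "P \<eta>" by (rule P'[OF sp])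
    have spR: "space (P \<eta>) = space M" using P'(2)[OF sp] by (rule sets_eq_imp_space_eq)
    have fm: "f \<in> borel_measurable (P \<eta>)" using P'(2)[OF sp] f by (simp cong: measurable_cong_sets)
    have fR: "integrable (P \<eta>) f"
      using f01 spR fm by (intro R.integrable_const_bound[where B=1]) (auto intro!: AE_I2)
    have "\<tau> * x \<le> r + exp \<tau> * (\<integral>y. f y \<partial>P \<eta>)" unfolding x_def
      using Q P'[OF sp] S(2)[OF \<eta>] fm f01 spR by (intro expectation_le_KL) auto
    then have "ennreal (\<tau> * x - r) \<le> ennreal (exp \<tau> * (\<integral>y. f y \<partial>P \<eta>))"
      by (intro ennreal_leI) simp
    also have "\<dots> = ennreal (exp \<tau>) * I \<eta>" unfolding I_def
      using fR f01 spR by (subst nn_integral_eq_integral) (auto simp: ennreal_mult' )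
    finally show ?thesis .
  qed
  have Iint: "(\<integral>\<^sup>+\<eta>. I \<eta> \<partial>p) \<le> ennreal (a + b)"
  proof -
    have "(\<integral>\<^sup>+\<eta>. I \<eta> \<partial>p) = (\<integral>\<^sup>+y. ennreal (f y) \<partial>(p \<bind> P))"
      unfolding I_def by (rule nn_integral_bind[symmetric, where B=M]) measurable
    also have "\<dots> = (\<integral>\<^sup>+y\<in>B. emeasure (\<kappa> y) A \<partial>(p \<bind> P))"
      using fe P'(2) p.not_empty by (intro nn_integral_cong) (auto simp: space_bind[where N=M])
    also have "\<dots> = (\<integral>\<^sup>+\<eta>\<in>A. emeasure (P \<eta>) B \<partial>p)" by (rule post_eq[symmetric])
    also have "\<dots> \<le> (\<integral>\<^sup>+\<eta>. indicator (space p - G) \<eta> + ennreal b \<partial>p)"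
    proof (rule nn_integral_mono)
      fix \<eta> assume \<eta>: "\<eta> \<in> space p"
      \<comment> \<open>On \<open>G\<close> the bound \<open>b\<close> applies; off \<open>G\<close>
        the first summand is the trivial bound 1.\<close>
      show "emeasure (P \<eta>) B * indicator A \<eta> \<le> indicator (space p - G) \<eta> + ennreal b"
      proof (cases "\<eta> \<in> A")
        case True
        then show ?thesis
          using b(1)[of \<eta>] prob_space.measure_le_1[OF P'(1)[OF \<eta>], of B] \<eta>
          by (cases "\<eta> \<in> G") (auto intro: order_trans)
      qed auto
    qed
    also have "\<dots> = emeasure p (space p - G) + ennreal b"
      by (subst nn_integral_add) (auto simp: p.emeasure_space_1)
    also have "\<dots> \<le> ennreal (a + b)"
      using a b(2) by (simp add: ennreal_plus add_right_mono)
    finally show ?thesis .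
  qed
  \<comment> \<open>The inequality \<open>step\<close> is integrated over \<open>S\<close> only, and
    then the domain is enlarged to the whole parameter space because \<open>I\<close> is
    nonnegative.\<close>
  have "ennreal s * ennreal (\<tau> * x - r) \<le> emeasure p S * ennreal (\<tau> * x - r)"
    using S by (intro mult_right_mono) auto
  also have "\<dots> = (\<integral>\<^sup>+\<eta>\<in>S. ennreal (\<tau> * x - r) \<partial>p)"
    by (subst nn_integral_cmult_indicator) (auto simp: mult.commute)
  also have "\<dots> \<le> (\<integral>\<^sup>+\<eta>. ennreal (exp \<tau>) * I \<eta> \<partial>p)"
    using step by (intro nn_integral_mono) (auto simp: indicator_def)
  also have "\<dots> = ennreal (exp \<tau>) * (\<integral>\<^sup>+\<eta>. I \<eta> \<partial>p)"
    by (rule nn_integral_cmult) measurable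
  also have "\<dots> \<le> ennreal (exp \<tau>) * ennreal (a + b)"
    using Iint by (intro mult_left_mono) auto
  finally have "ennreal (s * (\<tau> * x - r)) \<le> ennreal (exp \<tau> * (a + b))"
    using S(3) by (simp add: ennreal_mult' )
  \<comment> \<open>Nonnegativity of the right side permits the return to real numbers, including
    the case where truncation made the left side 0.\<close>
  moreover have "0 \<le> exp \<tau> * (a + b)" using a b by simp
  ultimately have "s * (\<tau> * x - r) \<le> exp \<tau> * (a + b)"
    by (simp add: ennreal_le_iff)
  then have "x \<le> (r + exp \<tau> * (a + b) / s) / \<tau>"
    using S(3) \<tau> by (simp add: field_simps)
  then show ?thesis unfolding LHS by (rule ennreal_leI)
qed

text \<open>Each set has a measurable hull of the same measure, so subadditivity carries over from
  measurable sets.\<close>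

lemma outer_measure_of_Un_le:
  assumes "A \<subseteq> space M" "B \<subseteq> space M"
  shows "outer_measure_of M (A \<union> B) \<le> outer_measure_of M A + outer_measure_of M B"
proof -
  obtain E where E: "E \<in> sets M" "A \<subseteq> E" "outer_measure_of M A = emeasure M E"
    using outer_measure_of_attain[OF assms(1)] by blast
  obtain F where F: "F \<in> sets M" "B \<subseteq> F" "outer_measure_of M B = emeasure M F"
    using outer_measure_of_attain[OF assms(2)] by blast
  have "outer_measure_of M (A \<union> B) \<le> outer_measure_of M (E \<union> F)"
    using E F by (intro outer_measure_of_mono) auto
  also have "\<dots> \<le> emeasure M E + emeasure M F"
    using E F by (simp add: emeasure_subadditive)
  finally show ?thesis using E F by simp
qed

lemma prob_vanishes_mono:
  assumes "prob_vanishes Q F"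
    and "\<forall>\<^sub>F n in sequentially. \<forall>y\<in>space (Q n). E n y \<longrightarrow> F n y"
  shows "prob_vanishes Q E"
  unfolding prob_vanishes_def
proof (rule tendsto_sandwich[OF _ _ tendsto_const])
  show "(\<lambda>n. outer_measure_of (Q n) {y \<in> space (Q n). F n y}) \<longlonglongrightarrow> 0"
    using assms(1) by (simp add: prob_vanishes_def)
  show "\<forall>\<^sub>F n in sequentially. outer_measure_of (Q n) {y \<in> space (Q n). E n y}
          \<le> outer_measure_of (Q n) {y \<in> space (Q n). F n y}"
    using assms(2) by eventually_elim (auto intro: outer_measure_of_mono)
qed simp

lemma prob_vanishes_disj:
  assumes "prob_vanishes Q E" "prob_vanishes Q F"
  shows "prob_vanishes Q (\<lambda>n y. E n y \<or> F n y)"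
  unfolding prob_vanishes_def
proof (rule tendsto_sandwich[OF _ _ tendsto_const])
  show "(\<lambda>n. outer_measure_of (Q n) {y \<in> space (Q n). E n y}
          + outer_measure_of (Q n) {y \<in> space (Q n). F n y}) \<longlonglongrightarrow> 0"
    using tendsto_add[OF assms[unfolded prob_vanishes_def]] by simp
  have "{y \<in> space (Q n). E n y \<or> F n y} = {y \<in> space (Q n). E n y} \<union> {y \<in> space (Q n). F n y}" for n
    by auto
  then show "\<forall>\<^sub>F n in sequentially. outer_measure_of (Q n) {y \<in> space (Q n). E n y \<or> F n y}
      \<le> outer_measure_of (Q n) {y \<in> space (Q n). E n y}
        + outer_measure_of (Q n) {y \<in> space (Q n). F n y}"
    by (auto intro!: always_eventually outer_measure_of_Un_le)
qed simp

lemma prob_vanishes_AE: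
  assumes "\<forall>\<^sub>F n in sequentially. AE y in Q n. \<not> E n y"
  shows "prob_vanishes Q E"
  unfolding prob_vanishes_def
proof (rule tendsto_eventually)
  show "\<forall>\<^sub>F n in sequentially. outer_measure_of (Q n) {y \<in> space (Q n). E n y} = 0"
    using assms
  proof eventually_elim
    case (elim n)
    then obtain N where N: "N \<in> null_sets (Q n)" "{y \<in> space (Q n). E n y} \<subseteq> N"
      by (auto simp: eventually_ae_filter)
    then have "outer_measure_of (Q n) {y \<in> space (Q n). E n y} \<le> emeasure (Q n) N"
      using outer_measure_of_mono[OF N(2), of "Q n"] by (simp add: null_setsD2)
    with N show ?case by (simp add: null_setsD1)
  qed
qed

text \<open>Markov's inequality; measurability of \<open>X n\<close> turns the outer measure into a
  measure. It is required only eventually because the model is constrained only for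
  \<open>n \<ge> 1\<close>.\<close>

lemma small_op_L1:
  assumes meas: "\<forall>\<^sub>F n in sequentially. X n \<in> borel_measurable (Q n)"
    and lim: "(\<lambda>n. \<integral>\<^sup>+y. X n y \<partial>Q n) \<longlonglongrightarrow> 0"
  shows "small_op Q X"
  unfolding small_op_def prob_vanishes_def
proof (intro allI impI)
  fix \<delta> :: real assume \<delta>: "\<delta> > 0"
  show "(\<lambda>n. outer_measure_of (Q n) {y \<in> space (Q n). X n y > ennreal \<delta>}) \<longlonglongrightarrow> 0"
  proof (rule tendsto_sandwich[OF _ _ tendsto_const])
    show "(\<lambda>n. ennreal (1 / \<delta>) * (\<integral>\<^sup>+y. X n y \<partial>Q n)) \<longlonglongrightarrow> 0"
      using ennreal_tendsto_cmult[OF _ lim, of "ennreal (1 / \<delta>)"] by simp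
    show "\<forall>\<^sub>F n in sequentially. outer_measure_of (Q n) {y \<in> space (Q n). X n y > ennreal \<delta>}
        \<le> ennreal (1 / \<delta>) * (\<integral>\<^sup>+y. X n y \<partial>Q n)"
      using meas
    proof eventually_elim
      case (elim n)
      note [measurable] = elim
      have "outer_measure_of (Q n) {y \<in> space (Q n). X n y > ennreal \<delta>}
          \<le> outer_measure_of (Q n) {y \<in> space (Q n). 1 \<le> ennreal (1 / \<delta>) * X n y}"
      proof (intro outer_measure_of_mono Collect_mono impI conjI; elim conjE)
        fix y assume "X n y > ennreal \<delta>"
        then have "ennreal (1 / \<delta>) * ennreal \<delta> \<le> ennreal (1 / \<delta>) * X n y"
          by (intro mult_left_mono) auto
        with \<delta> show "1 \<le> ennreal (1 / \<delta>) * X n y"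
          by (simp flip: ennreal_mult')
      qed
      also have "\<dots> = emeasure (Q n) {y \<in> space (Q n). 1 \<le> ennreal (1 / \<delta>) * X n y}"
        by (intro outer_measure_of_eq) measurable
      also have "\<dots> \<le> ennreal (1 / \<delta>) * (\<integral>\<^sup>+y\<in>space (Q n). X n y \<partial>Q n)"
        by (intro nn_integral_Markov_inequality) auto
      also have "(\<integral>\<^sup>+y\<in>space (Q n). X n y \<partial>Q n) = (\<integral>\<^sup>+y. X n y \<partial>Q n)"
        by (intro nn_integral_cong) auto
      finally show ?case .
    qed
  qed simp
qed

text \<open>The preimage of \<open>A\<close> under \<open>Pair \<theta>\<close> is its section at
  \<open>\<theta>\<close>. Applied at fixed data, this reduces the cut posterior to an integral
  against the marginal posterior of \<open>\<theta>\<close> alone.\<close>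

lemma emeasure_cut_joint:
  assumes m: "sets m = sets \<Theta>" "space m \<noteq> {}" and \<kappa>: "\<kappa> \<in> \<Theta> \<rightarrow>\<^sub>M prob_algebra F"
    and A: "A \<in> sets (\<Theta> \<Otimes>\<^sub>M F)"
  shows "emeasure (cut_joint \<Theta> F m \<kappa>) A = (\<integral>\<^sup>+\<theta>. emeasure (\<kappa> \<theta>) (Pair \<theta> -` A) \<partial>m)"
proof -
  note \<kappa>'[measurable] = measurable_prob_algebraD[OF \<kappa>]
  note [measurable_cong] = m(1)
  have sp: "space m = space \<Theta>" using m(1) by (rule sets_eq_imp_space_eq)
  have "emeasure (cut_joint \<Theta> F m \<kappa>) A
      = (\<integral>\<^sup>+\<theta>. emeasure (distr (\<kappa> \<theta>) (\<Theta> \<Otimes>\<^sub>M F) (Pair \<theta>)) A \<partial>m)"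
    unfolding cut_joint_def using m A
    by (intro emeasure_bind[where N="\<Theta> \<Otimes>\<^sub>M F"] measurable_distr2[where M=F]) auto
  also have "\<dots> = (\<integral>\<^sup>+\<theta>. emeasure (\<kappa> \<theta>) (Pair \<theta> -` A) \<partial>m)"
  proof (rule nn_integral_cong)
    fix \<theta> assume "\<theta> \<in> space m"
    then have \<theta>: "\<theta> \<in> space \<Theta>" using sp by simp
    then have s: "sets (\<kappa> \<theta>) = sets F" by (rule sets_kernel[OF \<kappa>'])
    then have sF: "space (\<kappa> \<theta>) = space F" by (rule sets_eq_imp_space_eq)
    have "Pair \<theta> \<in> \<kappa> \<theta> \<rightarrow>\<^sub>M \<Theta> \<Otimes>\<^sub>M F" using \<theta> s by (simp cong: measurable_cong_sets)
    moreover have "Pair \<theta> -` A \<inter> space F = Pair \<theta> -` A"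
      using sets.sets_into_space[OF A] by (auto simp: space_pair_measure)
    ultimately show "emeasure (distr (\<kappa> \<theta>) (\<Theta> \<Otimes>\<^sub>M F) (Pair \<theta>)) A = emeasure (\<kappa> \<theta>) (Pair \<theta> -` A)"
      using A sF by (simp add: emeasure_distr)
  qed
  finally show ?thesis .
qed

text \<open>On \<open>T \<inter> T'\<close> the density \<open>\<pi>\<close> is replaced by
  \<open>\<phi>'\<close> at the price of their distance. Elsewhere \<open>\<phi>\<close> or
  \<open>\<phi>'\<close> vanishes, so \<open>\<pi>\<close> itself is one of the two differences.
  Thus \<open>\<phi>\<close> localises to \<open>T\<close>, while \<open>\<phi>'\<close> carries the
  remaining integral.\<close>

lemma nn_integral_density_le_approx:
  fixes \<pi> \<phi> \<phi>' :: "'t \<Rightarrow> real" and g :: "'t \<Rightarrow> ennreal"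
  assumes [measurable]: "\<pi> \<in> borel_measurable \<mu>" "\<phi> \<in> borel_measurable \<mu>" "\<phi>' \<in> borel_measurable \<mu>"
      "g \<in> borel_measurable \<mu>" "T \<in> sets \<mu>" "T' \<in> sets \<mu>"
    and \<phi>: "\<And>\<theta>. \<theta> \<in> space \<mu> \<Longrightarrow> \<theta> \<notin> T \<Longrightarrow> \<phi> \<theta> = 0"
    and \<phi>': "\<And>\<theta>. \<theta> \<in> space \<mu> \<Longrightarrow> 0 \<le> \<phi>' \<theta>" "\<And>\<theta>. \<theta> \<in> space \<mu> \<Longrightarrow> \<theta> \<notin> T' \<Longrightarrow> \<phi>' \<theta> = 0"
    and g: "\<And>\<theta>. \<theta> \<in> space \<mu> \<Longrightarrow> g \<theta> \<le> 1"
  shows "(\<integral>\<^sup>+\<theta>. g \<theta> \<partial>density \<mu> (\<lambda>\<theta>. ennreal (\<pi> \<theta>)))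
    \<le> (\<integral>\<^sup>+\<theta>. ennreal \<bar>\<pi> \<theta> - \<phi> \<theta>\<bar> \<partial>\<mu>) + (\<integral>\<^sup>+\<theta>. ennreal \<bar>\<pi> \<theta> - \<phi>' \<theta>\<bar> \<partial>\<mu>)
      + (\<integral>\<^sup>+\<theta>\<in>T \<inter> T'. (ennreal (\<phi>' \<theta>) * g \<theta>) \<partial>\<mu>)"
proof -
  have "(\<integral>\<^sup>+\<theta>. g \<theta> \<partial>density \<mu> (\<lambda>\<theta>. ennreal (\<pi> \<theta>))) = (\<integral>\<^sup>+\<theta>. ennreal (\<pi> \<theta>) * g \<theta> \<partial>\<mu>)"
    by (rule nn_integral_density) measurable
  also have "\<dots> \<le> (\<integral>\<^sup>+\<theta>. ennreal \<bar>\<pi> \<theta> - \<phi> \<theta>\<bar> + ennreal \<bar>\<pi> \<theta> - \<phi>' \<theta>\<bar>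
      + ennreal (\<phi>' \<theta>) * g \<theta> * indicator (T \<inter> T') \<theta> \<partial>\<mu>)"
  proof (rule nn_integral_mono)
    fix \<theta> assume \<theta>: "\<theta> \<in> space \<mu>"
    show "ennreal (\<pi> \<theta>) * g \<theta> \<le> ennreal \<bar>\<pi> \<theta> - \<phi> \<theta>\<bar> + ennreal \<bar>\<pi> \<theta> - \<phi>' \<theta>\<bar>
      + ennreal (\<phi>' \<theta>) * g \<theta> * indicator (T \<inter> T') \<theta>"
    proof (cases "\<theta> \<in> T \<inter> T'")
      case True
      have "ennreal (\<pi> \<theta>) * g \<theta> \<le> ennreal (\<bar>\<pi> \<theta> - \<phi>' \<theta>\<bar> + \<phi>' \<theta>) * g \<theta>"
        by (intro mult_right_mono ennreal_leI) auto
      also have "\<dots> = ennreal \<bar>\<pi> \<theta> - \<phi>' \<theta>\<bar> * g \<theta> + ennreal (\<phi>' \<theta>) * g \<theta>"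
        using \<phi>'(1)[OF \<theta>] by (simp add: ennreal_plus distrib_right)
      also have "\<dots> \<le> ennreal \<bar>\<pi> \<theta> - \<phi>' \<theta>\<bar> * 1 + ennreal (\<phi>' \<theta>) * g \<theta>"
        using g[OF \<theta>] by (intro add_mono mult_left_mono) auto
      also have "\<dots> \<le> ennreal \<bar>\<pi> \<theta> - \<phi> \<theta>\<bar> + (ennreal \<bar>\<pi> \<theta> - \<phi>' \<theta>\<bar> + ennreal (\<phi>' \<theta>) * g \<theta>)"
        by (simp add: add_increasing)
      finally show ?thesis using True by (simp add: add.assoc)
    next
      case False
      have "ennreal (\<pi> \<theta>) * g \<theta> \<le> ennreal (\<bar>\<pi> \<theta> - \<phi> \<theta>\<bar> + \<bar>\<pi> \<theta> - \<phi>' \<theta>\<bar>) * 1"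
        using False \<phi>[OF \<theta>] \<phi>'(2)[OF \<theta>] g[OF \<theta>] by (intro mult_mono ennreal_leI) auto
      with False show ?thesis by (simp add: ennreal_plus)
    qed
  qed
  also have "\<dots> = (\<integral>\<^sup>+\<theta>. ennreal \<bar>\<pi> \<theta> - \<phi> \<theta>\<bar> \<partial>\<mu>) + (\<integral>\<^sup>+\<theta>. ennreal \<bar>\<pi> \<theta> - \<phi>' \<theta>\<bar> \<partial>\<mu>)
      + (\<integral>\<^sup>+\<theta>\<in>T \<inter> T'. (ennreal (\<phi>' \<theta>) * g \<theta>) \<partial>\<mu>)"
    by (simp add: nn_integral_add)
  finally show ?thesis .
qed

text \<open>Cauchy-Schwarz on the product space for \<open>u\<close> and \<open>v\<close>, the
  restrictions of \<open>f\<close> and \<open>h\<close> to \<open>T\<close>. As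
  \<open>h \<le> 1\<close>, its square is at most \<open>h\<close>; integrating over
  \<open>y\<close> first then makes the uniform bound \<open>\<beta>\<close> applicable.\<close>

lemma nn_integral_mult_power2_le:
  fixes f h :: "'b \<Rightarrow> 't \<Rightarrow> ennreal"
  assumes Q: "sigma_finite_measure Q" and \<mu>: "sigma_finite_measure \<mu>"
    and f: "case_prod f \<in> borel_measurable (Q \<Otimes>\<^sub>M \<mu>)"
    and h: "case_prod h \<in> borel_measurable (Q \<Otimes>\<^sub>M \<mu>)"
      "\<And>y \<theta>. y \<in> space Q \<Longrightarrow> \<theta> \<in> space \<mu> \<Longrightarrow> h y \<theta> \<le> 1"
    and T: "T \<in> sets \<mu>" and \<beta>: "\<And>\<theta>. \<theta> \<in> T \<Longrightarrow> (\<integral>\<^sup>+y. h y \<theta> \<partial>Q) \<le> \<beta>"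
  shows "(\<integral>\<^sup>+y. (\<integral>\<^sup>+\<theta>\<in>T. (f y \<theta> * h y \<theta>) \<partial>\<mu>) \<partial>Q)\<^sup>2
    \<le> (\<integral>\<^sup>+y. (\<integral>\<^sup>+\<theta>\<in>T. (f y \<theta>)\<^sup>2 \<partial>\<mu>) \<partial>Q) * (emeasure \<mu> T * \<beta>)"
proof -
  interpret Q: sigma_finite_measure Q by fact
  interpret \<mu>: sigma_finite_measure \<mu> by fact
  interpret pair_sigma_finite Q \<mu> ..
  note [measurable] = f h(1) T
  define u where "u = (\<lambda>(y, \<theta>). f y \<theta> * indicator T \<theta>)"
  define v where "v = (\<lambda>(y, \<theta>). h y \<theta> * indicator T \<theta>)"
  have [measurable]: "u \<in> borel_measurable (Q \<Otimes>\<^sub>M \<mu>)" "v \<in> borel_measurable (Q \<Otimes>\<^sub>M \<mu>)"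
    unfolding u_def v_def by measurable
  have "(\<integral>\<^sup>+y. (\<integral>\<^sup>+\<theta>\<in>T. (f y \<theta> * h y \<theta>) \<partial>\<mu>) \<partial>Q) = (\<integral>\<^sup>+y. (\<integral>\<^sup>+\<theta>. u (y, \<theta>) * v (y, \<theta>) \<partial>\<mu>) \<partial>Q)"
    by (intro nn_integral_cong) (auto simp: u_def v_def indicator_def)
  also have "\<dots> = (\<integral>\<^sup>+x. u x * v x \<partial>(Q \<Otimes>\<^sub>M \<mu>))"
    by (subst \<mu>.nn_integral_fst[symmetric]) auto
  finally have 1: "(\<integral>\<^sup>+y. (\<integral>\<^sup>+\<theta>\<in>T. (f y \<theta> * h y \<theta>) \<partial>\<mu>) \<partial>Q) = (\<integral>\<^sup>+x. u x * v x \<partial>(Q \<Otimes>\<^sub>M \<mu>))" .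
  have "(\<integral>\<^sup>+x. (u x)\<^sup>2 \<partial>(Q \<Otimes>\<^sub>M \<mu>)) = (\<integral>\<^sup>+y. (\<integral>\<^sup>+\<theta>. (u (y, \<theta>))\<^sup>2 \<partial>\<mu>) \<partial>Q)"
    by (subst \<mu>.nn_integral_fst[symmetric]) auto
  also have "\<dots> = (\<integral>\<^sup>+y. (\<integral>\<^sup>+\<theta>\<in>T. (f y \<theta>)\<^sup>2 \<partial>\<mu>) \<partial>Q)"
    by (intro nn_integral_cong) (auto simp: u_def indicator_def)
  finally have 2: "(\<integral>\<^sup>+x. (u x)\<^sup>2 \<partial>(Q \<Otimes>\<^sub>M \<mu>)) = (\<integral>\<^sup>+y. (\<integral>\<^sup>+\<theta>\<in>T. (f y \<theta>)\<^sup>2 \<partial>\<mu>) \<partial>Q)" .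
  have "(\<integral>\<^sup>+x. (v x)\<^sup>2 \<partial>(Q \<Otimes>\<^sub>M \<mu>)) = (\<integral>\<^sup>+\<theta>. (\<integral>\<^sup>+y. (v (y, \<theta>))\<^sup>2 \<partial>Q) \<partial>\<mu>)"
    by (subst nn_integral_snd[symmetric]) auto
  also have "\<dots> \<le> (\<integral>\<^sup>+\<theta>. \<beta> * indicator T \<theta> \<partial>\<mu>)"
  proof (rule nn_integral_mono)
    fix \<theta> assume \<theta>: "\<theta> \<in> space \<mu>"
    show "(\<integral>\<^sup>+y. (v (y, \<theta>))\<^sup>2 \<partial>Q) \<le> \<beta> * indicator T \<theta>"
    proof (cases "\<theta> \<in> T")
      case True
      have "(\<integral>\<^sup>+y. (v (y, \<theta>))\<^sup>2 \<partial>Q) \<le> (\<integral>\<^sup>+y. h y \<theta> \<partial>Q)"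
      proof (rule nn_integral_mono)
        fix y assume "y \<in> space Q"
        then have "h y \<theta> * h y \<theta> \<le> h y \<theta> * 1" using \<theta> h(2) by (intro mult_left_mono) auto
        then show "(v (y, \<theta>))\<^sup>2 \<le> h y \<theta>" using True by (simp add: v_def power2_eq_square)
      qed
      with \<beta>[OF True] True show ?thesis by simp
    qed (simp add: v_def)
  qed
  also have "\<dots> = emeasure \<mu> T * \<beta>"
    by (simp add: nn_integral_cmult mult.commute)
  finally have 3: "(\<integral>\<^sup>+x. (v x)\<^sup>2 \<partial>(Q \<Otimes>\<^sub>M \<mu>)) \<le> emeasure \<mu> T * \<beta>" .
  have "(\<integral>\<^sup>+x. u x * v x \<partial>(Q \<Otimes>\<^sub>M \<mu>))\<^sup>2 \<le> (\<integral>\<^sup>+x. (u x)\<^sup>2 \<partial>(Q \<Otimes>\<^sub>M \<mu>)) * (\<integral>\<^sup>+x. (v x)\<^sup>2 \<partial>(Q \<Otimes>\<^sub>M \<mu>))"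
    by (rule Cauchy_Schwarz_nn_integral) measurable
  also have "\<dots> \<le> (\<integral>\<^sup>+x. (u x)\<^sup>2 \<partial>(Q \<Otimes>\<^sub>M \<mu>)) * (emeasure \<mu> T * \<beta>)"
    using 3 by (intro mult_left_mono) auto
  finally show ?thesis unfolding 1 2 .
qed

lemma ennreal_le_sqrt:
  fixes x :: ennreal
  assumes "x\<^sup>2 \<le> ennreal r"
  shows "x \<le> ennreal (sqrt r)"
proof (cases x)
  case (real t)
  show ?thesis
  proof (cases "r \<ge> 0")
    case True
    with assms real have "t\<^sup>2 \<le> r" by (simp add: ennreal_power)
    then show ?thesis using real by (auto intro!: ennreal_leI real_le_rsqrt)
  next
    case False
    with assms real show ?thesis by (simp add: ennreal_neg ennreal_power)
  qed
next
  case top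
  with assms show ?thesis by (simp add: power2_eq_square ennreal_mult_top top_unique)
qed

text \<open>The choice \<open>\<tau> = l * N / 2\<close> spends half of the exponent
  \<open>l * N\<close> on \<open>exp \<tau>\<close>; the other half pays for the prior mass, as
  \<open>C \<le> l / 2\<close>. What is left is at most \<open>1 + C'\<close>, absorbed into a
  multiple of \<open>N\<close> by \<open>N \<ge> 1\<close>, and division by \<open>\<tau>\<close>
  leaves order \<open>1 / l\<close>.\<close>

lemma exponential_balance:
  fixes l N C C' :: real
  assumes "N \<ge> 1" "l > 0" "l \<ge> 2 * C" "C' \<ge> 0"
  shows "(N + exp (l * N / 2) * (exp (- l * N) + C' * exp (- 2 * l * N)) / exp (- C * N)) / (l * N / 2)
    \<le> 2 * (2 + C') / l"
proof -
  have e1: "exp (l * N / 2) * exp (- l * N) * exp (C * N) \<le> 1"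
  proof -
    have "l * N / 2 + - l * N + C * N = - ((l / 2 - C) * N)" by (simp add: field_simps)
    moreover have "(l / 2 - C) * N \<ge> 0" using assms by (intro mult_nonneg_nonneg) auto
    ultimately show ?thesis by (simp flip: exp_add)
  qed
  have "exp (- 2 * l * N) \<le> exp (- l * N)" using assms by simp
  then have "exp (l * N / 2) * (exp (- l * N) + C' * exp (- 2 * l * N)) * exp (C * N)
    \<le> exp (l * N / 2) * (exp (- l * N) + C' * exp (- l * N)) * exp (C * N)"
    using assms by (intro mult_right_mono mult_left_mono add_mono) auto
  also have "\<dots> = (1 + C') * (exp (l * N / 2) * exp (- l * N) * exp (C * N))"
    by (simp add: algebra_simps)
  also have "\<dots> \<le> (1 + C') * 1" using e1 assms by (intro mult_left_mono) auto
  also have "\<dots> \<le> (1 + C') * N" using assms by (intro mult_left_mono) auto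
  finally have "N + exp (l * N / 2) * (exp (- l * N) + C' * exp (- 2 * l * N)) / exp (- C * N)
      \<le> (2 + C') * N"
    by (simp add: exp_minus field_simps)
  then have "(N + exp (l * N / 2) * (exp (- l * N) + C' * exp (- 2 * l * N)) / exp (- C * N)) / (l * N / 2)
     \<le> (2 + C') * N / (l * N / 2)"
    using assms by (intro divide_right_mono) auto
  also have "\<dots> = 2 * (2 + C') / l" using assms by (simp add: field_simps)
  finally show ?thesis .
qed

theorem theoremS2p7:
  fixes Y :: "'y measure"
    and \<T> :: "'a::euclidean_space set"
    and \<Theta> \<mu> :: "'a measure"
    and F1 F2 :: "'e measure"
    and P :: "nat \<Rightarrow> 'a \<Rightarrow> 'e \<Rightarrow> (nat \<Rightarrow> 'y) measure"
    and \<theta>0 :: 'a and \<eta>0 :: 'e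
    and \<Pi>1 :: "('a \<times> 'e) measure"
    and post1 :: "nat \<Rightarrow> (nat \<Rightarrow> 'y) \<Rightarrow> ('a \<times> 'e) measure"
    and mpost1 :: "nat \<Rightarrow> (nat \<Rightarrow> 'y) \<Rightarrow> 'a measure"
    and \<pi>1 :: "nat \<Rightarrow> (nat \<Rightarrow> 'y) \<Rightarrow> 'a \<Rightarrow> real"
    and \<Pi>2 :: "'a \<Rightarrow> 'e measure"
    and post2 :: "nat \<Rightarrow> 'a \<Rightarrow> (nat \<Rightarrow> 'y) \<Rightarrow> 'e measure"
    and cut :: "nat \<Rightarrow> (nat \<Rightarrow> 'y) \<Rightarrow> ('a \<times> 'e) measure"
    and l :: nat
    and d :: "(nat \<Rightarrow> 'y) measure \<Rightarrow> (nat \<Rightarrow> 'y) measure \<Rightarrow> ennreal"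
    and z \<epsilon> L K :: "nat \<Rightarrow> real"
    and T :: "nat \<Rightarrow> 'a set"
    and \<phi> :: "nat \<Rightarrow> (nat \<Rightarrow> 'y) \<Rightarrow> 'a \<Rightarrow> real"
    and C C' :: real
    and S F2n :: "nat \<Rightarrow> 'a \<Rightarrow> 'e set"
    and \<psi> :: "nat \<Rightarrow> (nat \<Rightarrow> 'y) \<Rightarrow> real"
  defines "\<Theta> \<equiv> restrict_space borel \<T>"
    and "mpost1 \<equiv> \<lambda>n y. distr (post1 n y) \<Theta> fst"
    and "cut \<equiv> \<lambda>n y. cut_joint \<Theta> F2 (mpost1 n y) (\<lambda>\<theta>. post2 n \<theta> y)"
  \<comment> \<open>sampling model; the parameter sets are \<open>\<T>\<close>, \<open>space F1\<close> and \<open>space F2\<close>\<close>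
  assumes P_F1: "\<forall>n\<ge>1. (\<lambda>(\<theta>, \<eta>). P n \<theta> \<eta>) \<in> \<Theta> \<Otimes>\<^sub>M F1 \<rightarrow>\<^sub>M prob_algebra (obs Y n)"
    and P_F2: "\<forall>n\<ge>1. (\<lambda>(\<theta>, \<eta>). P n \<theta> \<eta>) \<in> \<Theta> \<Otimes>\<^sub>M F2 \<rightarrow>\<^sub>M prob_algebra (obs Y n)"
    and truth: "\<theta>0 \<in> \<T>" "\<eta>0 \<in> space F2"
  \<comment> \<open>Model 1\<close>
    and prior1: "\<Pi>1 \<in> space (prob_algebra (\<Theta> \<Otimes>\<^sub>M F1))"
    and post1: "\<forall>n\<ge>1. is_posterior \<Pi>1 (\<lambda>(\<theta>, \<eta>). P n \<theta> \<eta>) (obs Y n) (post1 n)"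
    and mu: "sigma_finite_measure \<mu>" "sets \<mu> = sets \<Theta>"
    and dens_meas: "\<forall>n\<ge>1. (\<lambda>(y, \<theta>). \<pi>1 n y \<theta>) \<in> borel_measurable (obs Y n \<Otimes>\<^sub>M \<mu>)"
    and dens_nonneg: "\<forall>n\<ge>1. \<forall>y\<in>space (obs Y n). \<forall>\<theta>\<in>\<T>. \<pi>1 n y \<theta> \<ge> 0"
    and dens: "\<forall>n\<ge>1. AE y in P n \<theta>0 \<eta>0. mpost1 n y = density \<mu> (\<lambda>\<theta>. ennreal (\<pi>1 n y \<theta>))"
  \<comment> \<open>Model 2\<close>
    and prior2: "\<Pi>2 \<in> \<Theta> \<rightarrow>\<^sub>M prob_algebra F2"
    and post2_meas:
      "\<forall>n\<ge>1. (\<lambda>(\<theta>, y). post2 n \<theta> y) \<in> \<Theta> \<Otimes>\<^sub>M obs Y n \<rightarrow>\<^sub>M prob_algebra F2"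
    and post2: "\<forall>n\<ge>1. \<forall>\<theta>\<in>\<T>. is_posterior (\<Pi>2 \<theta>) (P n \<theta>) (obs Y n) (post2 n \<theta>)"
  \<comment> \<open>loss\<close>
    and l_pos: "l > 0"
    and loss_meas:
      "(\<lambda>(\<theta>, \<eta>). d (P l \<theta> \<eta>) (P l \<theta>0 \<eta>0)) \<in> borel_measurable (\<Theta> \<Otimes>\<^sub>M F2)"
  \<comment> \<open>approximation of the marginal posterior density\<close>
    and approx_all: "\<forall>z'. filterlim z' at_top sequentially \<longrightarrow>
      (\<exists>T' \<epsilon>' \<phi>'. posterior_approx (obs Y) (\<lambda>n. P n \<theta>0 \<eta>0) \<mu> \<theta>0 \<pi>1 z' T' \<epsilon>' \<phi>')"
    and z: "filterlim z at_top sequentially"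
    and approx: "posterior_approx (obs Y) (\<lambda>n. P n \<theta>0 \<eta>0) \<mu> \<theta>0 \<pi>1 z T \<epsilon> \<phi>"
  \<comment> \<open>prior mass\<close>
    and C_pos: "C > 0"
    and S_sets: "\<forall>n\<ge>1. \<forall>\<theta>\<in>T n. S n \<theta> \<in> sets F2"
    and S_KL: "\<forall>n\<ge>1. Sigma (T n) (S n) \<subseteq> KL_nbhd (P n) \<theta>0 \<eta>0 n (\<epsilon> n)"
    and S_mass: "\<forall>n\<ge>1. (INF \<theta>\<in>T n. emeasure (\<Pi>2 \<theta>) (S n \<theta>))
                    \<ge> ennreal (exp (- C * real n * (\<epsilon> n)\<^sup>2))"
  \<comment> \<open>sieve and tests\<close>
    and L: "filterlim L at_top sequentially"
    and F2n_sets: "\<forall>n\<ge>1. \<forall>\<theta>\<in>T n. F2n n \<theta> \<in> sets F2"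
    and F2n_mass: "\<forall>n\<ge>1. (SUP \<theta>\<in>T n. emeasure (\<Pi>2 \<theta>) (space F2 - F2n n \<theta>))
                    \<le> ennreal (exp (- L n * real n * (\<epsilon> n)\<^sup>2))"
    and psi: "\<forall>n\<ge>1. \<psi> n \<in> borel_measurable (obs Y n)"
             "\<forall>n\<ge>1. \<forall>y\<in>space (obs Y n). \<psi> n y \<in> {0, 1}"
    and psi_null: "(\<lambda>n. \<integral>\<^sup>+y. ennreal (\<psi> n y) \<partial>P n \<theta>0 \<eta>0) \<longlonglongrightarrow> 0"
    and K_pos: "\<forall>n\<ge>1. K n > 0"
    and C'_pos: "C' > 0"
    and psi_alt: "\<forall>n\<ge>1.
      (SUP (\<theta>, \<eta>) \<in> {(\<theta>, \<eta>) \<in> Sigma (T n) (F2n n).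
                        d (P l \<theta> \<eta>) (P l \<theta>0 \<eta>0) > ennreal (K n * \<epsilon> n)}.
         \<integral>\<^sup>+y. ennreal (1 - \<psi> n y) \<partial>P n \<theta> \<eta>)
        \<le> ennreal (C' * exp (- 2 * L n * real n * (\<epsilon> n)\<^sup>2))"
  \<comment> \<open>The loss being exactly \<open>K\<^sub>n \<epsilon>\<^sub>n\<close> is not controlled by \<open>psi_alt\<close>, but belongs to the complement
    of the open ball; see the second conjunct.\<close>
  shows "small_op (\<lambda>n. P n \<theta>0 \<eta>0)
           (\<lambda>n y. emeasure (cut n y)
              {(\<theta>, \<eta>) \<in> \<T> \<times> space F2. d (P l \<theta> \<eta>) (P l \<theta>0 \<eta>0) > ennreal (K n * \<epsilon> n)}) \<and>
         ((\<forall>n\<ge>1.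
            (SUP (\<theta>, \<eta>) \<in> {(\<theta>, \<eta>) \<in> Sigma (T n) (F2n n).
                              d (P l \<theta> \<eta>) (P l \<theta>0 \<eta>0) = ennreal (K n * \<epsilon> n)}.
               \<integral>\<^sup>+y. ennreal (1 - \<psi> n y) \<partial>P n \<theta> \<eta>)
              \<le> ennreal (C' * exp (- 2 * L n * real n * (\<epsilon> n)\<^sup>2))) \<longrightarrow>
          small_op (\<lambda>n. P n \<theta>0 \<eta>0)
            (\<lambda>n y. emeasure (cut n y)
               (\<T> \<times> space F2 - loss_ball d (P l) \<theta>0 \<eta>0 (K n * \<epsilon> n))))"
proof -

  \<comment> \<open>Sampling laws, priors and posteriors as probability measures\<close>
  note \<Theta>_eq = assms(1) and mpost1_eq = assms(2) and cut_eq = assms(3)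
  define M where "M = obs Y"
  define Q where "Q = (\<lambda>n. P n \<theta>0 \<eta>0)"
  have Q_n: "Q n = P n \<theta>0 \<eta>0" for n by (simp add: Q_def)
  note P_F2 = P_F2[folded M_def] and post2 = post2[folded M_def] and psi = psi[folded M_def]
    and dens_meas = dens_meas[folded M_def] and post2_meas = post2_meas[folded M_def]
    and dens = dens[folded Q_n]
    and psi_null = psi_null[folded Q_n]
  have sp\<Theta>: "space \<Theta> = \<T>" by (simp add: \<Theta>_eq space_restrict_space)
  have sp\<mu>: "space \<mu> = \<T>" using sets_eq_imp_space_eq[OF mu(2)] sp\<Theta> by simp
  note [measurable_cong] = mu(2)
  interpret \<mu>: sigma_finite_measure \<mu> by (rule mu(1))
  have P': "prob_space (P n \<theta> \<eta>)" "sets (P n \<theta> \<eta>) = sets (M n)" "space (P n \<theta> \<eta>) = space (M n)"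
    if "n \<ge> 1" "\<theta> \<in> \<T>" "\<eta> \<in> space F2" for n \<theta> \<eta>
  proof -
    have "P n \<theta> \<eta> \<in> space (prob_algebra (M n))"
      using measurable_space[OF P_F2[rule_format, OF that(1)], of "(\<theta>, \<eta>)"] that sp\<Theta>
      by (simp add: space_pair_measure)
    then show "prob_space (P n \<theta> \<eta>)" "sets (P n \<theta> \<eta>) = sets (M n)"
      by (auto simp: space_prob_algebra)
    then show "space (P n \<theta> \<eta>) = space (M n)" by (intro sets_eq_imp_space_eq)
  qed
  have Q': "prob_space (Q n)" "sets (Q n) = sets (M n)" "space (Q n) = space (M n)"
    if "n \<ge> 1" for n
    using P'[OF that truth] by (auto simp: Q_def)
  have \<Pi>2': "prob_space (\<Pi>2 \<theta>)" "sets (\<Pi>2 \<theta>) = sets F2" "space (\<Pi>2 \<theta>) = space F2"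
    if "\<theta> \<in> \<T>" for \<theta>
  proof -
    show "prob_space (\<Pi>2 \<theta>)" and s: "sets (\<Pi>2 \<theta>) = sets F2"
      using measurable_space[OF prior2, of \<theta>] that sp\<Theta> by (auto simp: space_prob_algebra)
    show "space (\<Pi>2 \<theta>) = space F2" using s by (rule sets_eq_imp_space_eq)
  qed
  have post2': "prob_space (post2 n \<theta> y)"
    if "n \<ge> 1" "\<theta> \<in> \<T>" "y \<in> space (M n)" for n \<theta> y
    using measurable_space[OF post2_meas[rule_format, OF that(1)], of "(\<theta>, y)"] that sp\<Theta>
    by (auto simp: space_pair_measure space_prob_algebra)

  \<comment> \<open>The two approximations of the marginal posterior density\<close>
  have "filterlim (\<lambda>n. sqrt (L n)) at_top sequentially"
    by (rule filterlim_compose[OF sqrt_at_top L])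
  \<comment> \<open>This approximation brings its own sets \<open>T' n\<close>, whereas prior mass,
    sieve and tests are controlled on \<open>T n\<close>; hence the later restriction to
    \<open>T n \<inter> T' n\<close>.\<close>
  then obtain T' \<epsilon>' \<phi>'
    where approx': "posterior_approx M Q \<mu> \<theta>0 \<pi>1 (\<lambda>n. sqrt (L n)) T' \<epsilon>' \<phi>'"
    using approx_all unfolding M_def Q_def by blast
  note approx = approx[folded M_def Q_def]
  have T: "T n \<in> sets \<mu>" and T': "T' n \<in> sets \<mu>" if "n \<ge> 1" for n
    using approx approx' that by (auto simp: posterior_approx_def)
  have T_sub: "\<theta> \<in> \<T>" if "n \<ge> 1" "\<theta> \<in> T n" for n \<theta>
    using sets.sets_into_space[OF T] that sp\<mu> by auto
  have N: "filterlim (\<lambda>n. real n * (\<epsilon> n)\<^sup>2) at_top sequentially"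
    using approx by (simp add: posterior_approx_def)
  have \<phi>: "case_prod (\<phi> n) \<in> borel_measurable (M n \<Otimes>\<^sub>M \<mu>)"
    "\<And>y \<theta>. y \<in> space (M n) \<Longrightarrow> \<theta> \<in> \<T> \<Longrightarrow> \<theta> \<notin> T n \<Longrightarrow> \<phi> n y \<theta> = 0" if "n \<ge> 1" for n
    using approx that unfolding posterior_approx_def sp\<mu> by auto
  have \<phi>': "case_prod (\<phi>' n) \<in> borel_measurable (M n \<Otimes>\<^sub>M \<mu>)"
    "\<And>y \<theta>. y \<in> space (M n) \<Longrightarrow> \<theta> \<in> \<T> \<Longrightarrow> 0 \<le> \<phi>' n y \<theta>"
    "\<And>y \<theta>. y \<in> space (M n) \<Longrightarrow> \<theta> \<in> \<T> \<Longrightarrow> \<theta> \<notin> T' n \<Longrightarrow> \<phi>' n y \<theta> = 0" if "n \<ge> 1" for n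
    using approx' that unfolding posterior_approx_def sp\<mu> by auto
  have D: "small_op Q (\<lambda>n y. \<integral>\<^sup>+\<theta>. ennreal \<bar>\<pi>1 n y \<theta> - \<phi> n y \<theta>\<bar> \<partial>\<mu>)"
    using approx by (simp add: posterior_approx_def)
  have D': "small_op Q (\<lambda>n y. \<integral>\<^sup>+\<theta>. ennreal \<bar>\<pi>1 n y \<theta> - \<phi>' n y \<theta>\<bar> \<partial>\<mu>)"
    using approx' by (simp add: posterior_approx_def)
  obtain c where c: "c > 0" and sq: "\<forall>\<^sub>F n in sequentially.
      emeasure \<mu> (T' n) * (\<integral>\<^sup>+y. (\<integral>\<^sup>+\<theta>\<in>T' n. ennreal ((\<phi>' n y \<theta>)\<^sup>2) \<partial>\<mu>) \<partial>Q n) \<le> ennreal (c * sqrt (L n))"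
    using approx' unfolding posterior_approx_def by blast

  \<comment> \<open>Error of the tests under the true law\<close>
  have \<psi>_op: "small_op Q (\<lambda>n y. ennreal (\<psi> n y))"
  proof (rule small_op_L1[OF _ psi_null])
    show "\<forall>\<^sub>F n in sequentially. (\<lambda>y. ennreal (\<psi> n y)) \<in> borel_measurable (Q n)"
      using eventually_ge_at_top[of 1]
    proof eventually_elim
      case (elim n)
      note [measurable] = psi(1)[rule_format, OF elim] and [measurable_cong] = Q'(2)[OF elim]
      show ?case by measurable
    qed
  qed

  \<comment> \<open>Cut posterior mass of general sets detected by the tests\<close>
  have main: "small_op Q (\<lambda>n y. emeasure (cut n y) (A n))"
    if A: "\<And>n. n \<ge> 1 \<Longrightarrow> A n \<in> sets (\<Theta> \<Otimes>\<^sub>M F2)"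
      and test: "\<And>n \<theta> \<eta>. n \<ge> 1 \<Longrightarrow> \<theta> \<in> T n \<Longrightarrow> \<eta> \<in> F2n n \<theta> \<Longrightarrow> (\<theta>, \<eta>) \<in> A n \<Longrightarrow>
        (\<integral>\<^sup>+y. ennreal (1 - \<psi> n y) \<partial>P n \<theta> \<eta>) \<le> ennreal (C' * exp (- 2 * L n * real n * (\<epsilon> n)\<^sup>2))"
    for A
  proof -
    define B where "B = (\<lambda>n. {y \<in> space (M n). \<psi> n y = 0})"
    have B: "B n \<in> sets (M n)" if "n \<ge> 1" for n
    proof -
      note [measurable] = psi(1)[rule_format, OF that]
      show ?thesis unfolding B_def by measurable
    qed
    have A\<theta>: "Pair \<theta> -` A n \<in> sets F2" if "n \<ge> 1" for n \<theta>
      by (rule sets_Pair1[OF A[OF that]])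
    \<comment> \<open>The function \<open>g\<close> of the proof idea for the set
      \<open>A n\<close>: as \<open>\<psi> n\<close> takes only the values 0 and 1, the factor
      \<open>1 - \<psi> n\<close> is the indicator of the acceptance region
      \<open>B n\<close>.\<close>
    define h where "h = (\<lambda>n y \<theta>. indicator (B n) y * emeasure (post2 n \<theta> y) (Pair \<theta> -` A n))"
    have h_meas: "case_prod (h n) \<in> borel_measurable (M n \<Otimes>\<^sub>M \<mu>)" if n: "n \<ge> 1" for n
    proof -
      note [measurable] = B[OF n] A[OF n] measurable_prob_algebraD[OF post2_meas[rule_format, OF n]]
      have "(\<lambda>x. emeasure (post2 n (snd x) (fst x)) (Pair (snd x) -` A n)) \<in> borel_measurable (M n \<Otimes>\<^sub>M \<mu>)"
      proof (rule emeasure_measurable_subprob_algebra2[where N=F2])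
        \<comment> \<open>Both the kernel and the evaluated section vary with \<open>x\<close>, so
          measurability is needed for the graph of the sections, a preimage of
          \<open>A n\<close>.\<close>
        have "(SIGMA x:space (M n \<Otimes>\<^sub>M \<mu>). Pair (snd x) -` A n)
          = (\<lambda>(x, \<eta>). (snd x, \<eta>)) -` A n \<inter> space ((M n \<Otimes>\<^sub>M \<mu>) \<Otimes>\<^sub>M F2)"
          using sets.sets_into_space[OF A[OF n]] by (auto simp: space_pair_measure)
        also have "\<dots> \<in> sets ((M n \<Otimes>\<^sub>M \<mu>) \<Otimes>\<^sub>M F2)"
          by (rule measurable_sets[OF _ A[OF n]]) measurable
        finally show "(SIGMA x:space (M n \<Otimes>\<^sub>M \<mu>). Pair (snd x) -` A n) \<in> sets ((M n \<Otimes>\<^sub>M \<mu>) \<Otimes>\<^sub>M F2)" .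
        show "(\<lambda>x. post2 n (snd x) (fst x)) \<in> M n \<Otimes>\<^sub>M \<mu> \<rightarrow>\<^sub>M subprob_algebra F2"
          by measurable
      qed
      then show ?thesis unfolding h_def case_prod_beta by measurable
    qed
    have h_le: "h n y \<theta> \<le> 1" if "n \<ge> 1" "y \<in> space (M n)" "\<theta> \<in> \<T>" for n y \<theta>
      using prob_space.measure_le_1[OF post2'[OF that(1,3,2)]] by (auto simp: h_def indicator_def)

    \<comment> \<open>Uniform bound on the true expectation of \<open>h\<close>\<close>
    have \<beta>: "\<forall>\<^sub>F n in sequentially. \<forall>\<theta>\<in>T n. (\<integral>\<^sup>+y. h n y \<theta> \<partial>Q n) \<le> ennreal (2 * (2 + C') / L n)"
      using eventually_ge_at_top[of 1] filterlim_at_top_dense[THEN iffD1, rule_format, OF L, of 0]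
        filterlim_at_top[THEN iffD1, rule_format, OF L, of "2 * C"]
        filterlim_at_top[THEN iffD1, rule_format, OF N, of 1]
    proof eventually_elim
      case (elim n)
      show ?case
      proof
        fix \<theta> assume \<theta>: "\<theta> \<in> T n"
        note n = elim(1)
        note \<theta>T = T_sub[OF n \<theta>]
        note \<Pi> = \<Pi>2'[OF \<theta>T]
        define r where "r = real n * (\<epsilon> n)\<^sup>2"
        have "(\<integral>\<^sup>+y. h n y \<theta> \<partial>Q n) = (\<integral>\<^sup>+y\<in>B n. emeasure (post2 n \<theta> y) (Pair \<theta> -` A n) \<partial>Q n)"
          by (simp add: h_def mult.commute)
        \<comment> \<open>Here \<open>r\<close> bounds the divergence,
          \<open>\<tau> = L n * r / 2\<close>, the prior mass is \<open>s = exp (- C * r)\<close>,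
          the sieve gives \<open>a = exp (- L n * r)\<close> and the tests give
          \<open>b = C' * exp (- 2 * L n * r)\<close>.\<close>
        also have "\<dots> \<le> ennreal ((r + exp (L n * r / 2)
            * (exp (- L n * r) + C' * exp (- 2 * L n * r)) / exp (- C * r)) / (L n * r / 2))"
        proof (rule posterior_expectation_le[where p="\<Pi>2 \<theta>" and P="P n \<theta>" and M="M n"
              and S="S n \<theta>" and G="F2n n \<theta>"])
          have "Pair \<theta> \<in> F2 \<rightarrow>\<^sub>M \<Theta> \<Otimes>\<^sub>M F2" using \<theta>T sp\<Theta> by simp
          from measurable_compose[OF this P_F2[rule_format, OF n]]
          show "P n \<theta> \<in> \<Pi>2 \<theta> \<rightarrow>\<^sub>M prob_algebra (M n)"
            using \<Pi>(2) by (simp cong: measurable_cong_sets)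
          show "is_posterior (\<Pi>2 \<theta>) (P n \<theta>) (M n) (post2 n \<theta>)" using post2 n \<theta>T by blast
          show "KL_div (Q n) (P n \<theta> \<eta>) \<le> ereal r" if "\<eta> \<in> S n \<theta>" for \<eta>
            using S_KL n \<theta> that unfolding KL_nbhd_def r_def Q_def by (fastforce intro: less_imp_le)
          have "ennreal (exp (- C * r)) \<le> (INF \<theta>\<in>T n. emeasure (\<Pi>2 \<theta>) (S n \<theta>))"
            using S_mass n by (simp add: r_def mult.assoc)
          also have "\<dots> \<le> emeasure (\<Pi>2 \<theta>) (S n \<theta>)" by (rule INF_lower[OF \<theta>])
          finally show "ennreal (exp (- C * r)) \<le> emeasure (\<Pi>2 \<theta>) (S n \<theta>)" .
          have "emeasure (\<Pi>2 \<theta>) (space F2 - F2n n \<theta>)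
              \<le> (SUP \<theta>\<in>T n. emeasure (\<Pi>2 \<theta>) (space F2 - F2n n \<theta>))"
            by (rule SUP_upper[OF \<theta>])
          also have "\<dots> \<le> ennreal (exp (- L n * r))"
            using F2n_mass n by (simp add: r_def mult.assoc)
          finally show "emeasure (\<Pi>2 \<theta>) (space (\<Pi>2 \<theta>) - F2n n \<theta>) \<le> ennreal (exp (- L n * r))"
            using \<Pi>(3) by simp
          fix \<eta> assume \<eta>: "\<eta> \<in> F2n n \<theta> \<inter> Pair \<theta> -` A n"
          have \<eta>F: "\<eta> \<in> space F2" using \<eta> F2n_sets n \<theta> sets.sets_into_space by blast
          note P'' = P'[OF n \<theta>T \<eta>F]
          have "emeasure (P n \<theta> \<eta>) (B n) = (\<integral>\<^sup>+y. indicator (B n) y \<partial>P n \<theta> \<eta>)"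
            using B[OF n] P'' by simp
          also have "\<dots> = (\<integral>\<^sup>+y. ennreal (1 - \<psi> n y) \<partial>P n \<theta> \<eta>)"
            using psi(2) n P'' by (intro nn_integral_cong) (fastforce simp: B_def indicator_def)
          also have "\<dots> \<le> ennreal (C' * exp (- 2 * L n * r))"
            using test[OF n \<theta>, of \<eta>] \<eta> by (simp add: r_def mult.assoc)
          finally show "emeasure (P n \<theta> \<eta>) (B n) \<le> ennreal (C' * exp (- 2 * L n * r))" .
        qed (use \<Pi> Q'[OF n] S_sets F2n_sets n \<theta> A\<theta>[OF n] B[OF n] elim C'_pos in \<open>auto simp: r_def\<close>)
        also have "\<dots> \<le> ennreal (2 * (2 + C') / L n)"
          using elim C'_pos by (intro ennreal_leI exponential_balance) (auto simp: r_def)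
        finally show "(\<integral>\<^sup>+y. h n y \<theta> \<partial>Q n) \<le> ennreal (2 * (2 + C') / L n)" .
      qed
    qed

    \<comment> \<open>Integration against the second approximation\<close>
    define J where "J = (\<lambda>n y. \<integral>\<^sup>+\<theta>\<in>T n \<inter> T' n. (ennreal (\<phi>' n y \<theta>) * h n y \<theta>) \<partial>\<mu>)"
    have J_meas: "J n \<in> borel_measurable (Q n)" if n: "n \<ge> 1" for n
    proof -
      note [measurable] = h_meas[OF n] \<phi>'(1)[OF n] T[OF n] T'[OF n]
      have "J n \<in> borel_measurable (M n)" unfolding J_def by measurable
      then show ?thesis using Q'(2)[OF n] by (simp cong: measurable_cong_sets)
    qed
    have J_le: "\<forall>\<^sub>F n in sequentially.
        (\<integral>\<^sup>+y. J n y \<partial>Q n) \<le> ennreal (sqrt (c * 2 * (2 + C') / sqrt (L n)))"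
      using \<beta> sq eventually_ge_at_top[of 1] filterlim_at_top_dense[THEN iffD1, rule_format, OF L, of 0]
    proof eventually_elim
      case (elim n)
      note n = elim(3)
      interpret Q: prob_space "Q n" by (rule Q'(1)[OF n])
      note [measurable_cong] = Q'(2)[OF n]
      note [measurable] = h_meas[OF n] \<phi>'(1)[OF n] T[OF n] T'[OF n]
      define I where "I = (\<integral>\<^sup>+y. (\<integral>\<^sup>+\<theta>\<in>T' n. ennreal ((\<phi>' n y \<theta>)\<^sup>2) \<partial>\<mu>) \<partial>Q n)"
      have "(\<integral>\<^sup>+y. J n y \<partial>Q n)\<^sup>2
        \<le> (\<integral>\<^sup>+y. (\<integral>\<^sup>+\<theta>\<in>T n \<inter> T' n. (ennreal (\<phi>' n y \<theta>))\<^sup>2 \<partial>\<mu>) \<partial>Q n)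
           * (emeasure \<mu> (T n \<inter> T' n) * ennreal (2 * (2 + C') / L n))"
        unfolding J_def using elim(1) h_le[OF n] Q'(3)[OF n] sp\<mu>
        by (intro nn_integral_mult_power2_le Q.sigma_finite_measure_axioms mu(1)) auto
      \<comment> \<open>Enlarging both factors to \<open>T' n\<close> produces exactly the product
        bounded in \<open>sq\<close>.\<close>
      also have "\<dots> \<le> I * (emeasure \<mu> (T' n) * ennreal (2 * (2 + C') / L n))"
        unfolding I_def using \<phi>'(2)[OF n] Q'(3)[OF n] sp\<mu>
        by (intro mult_mono nn_integral_mono emeasure_mono)
          (auto simp: ennreal_power indicator_def)
      also have "\<dots> = (emeasure \<mu> (T' n) * I) * ennreal (2 * (2 + C') / L n)"
        by (simp add: ac_simps)
      \<comment> \<open>The growth \<open>sqrt (L n)\<close> of the second moment meets the decay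
        \<open>1 / L n\<close> of the expectation, leaving \<open>1 / sqrt (L n)\<close>.\<close>
      also have "\<dots> \<le> ennreal (c * sqrt (L n)) * ennreal (2 * (2 + C') / L n)"
        using elim(2) unfolding I_def by (intro mult_right_mono) auto
      also have "\<dots> = ennreal (c * sqrt (L n) * (2 * (2 + C') / L n))"
        using c elim by (intro ennreal_mult'[symmetric]) auto
      also have "c * sqrt (L n) * (2 * (2 + C') / L n) = c * 2 * (2 + C') / sqrt (L n)"
      proof -
        have "c * sqrt (L n) * (2 * (2 + C') / L n) = c * 2 * (2 + C') * (sqrt (L n) / L n)"
          by simp
        also have "sqrt (L n) / L n = inverse (sqrt (L n))"
          using elim(4) by (intro sqrt_divide_self_eq) simp
        finally show ?thesis by (simp only: divide_inverse)
      qed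
      finally show ?case by (rule ennreal_le_sqrt)
    qed
    have J_lim: "(\<lambda>n. \<integral>\<^sup>+y. J n y \<partial>Q n) \<longlonglongrightarrow> 0"
    proof (rule tendsto_sandwich[OF _ J_le tendsto_const])
      have "(\<lambda>n. c * 2 * (2 + C') / sqrt (L n)) \<longlonglongrightarrow> 0"
        by (intro real_tendsto_divide_at_top[OF tendsto_const] filterlim_compose[OF sqrt_at_top L])
      then have "(\<lambda>n. ennreal (sqrt (c * 2 * (2 + C') / sqrt (L n)))) \<longlonglongrightarrow> ennreal (sqrt 0)"
        by (intro tendsto_ennrealI tendsto_real_sqrt)
      then show "(\<lambda>n. ennreal (sqrt (c * 2 * (2 + C') / sqrt (L n)))) \<longlonglongrightarrow> 0" by simp
    qed simp
    have J_op: "small_op Q J"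
      by (rule small_op_L1[OF _ J_lim]) (auto intro: eventually_sequentiallyI J_meas)

    \<comment> \<open>Decomposition of the cut posterior mass when the test accepts\<close>
    have cut_le: "emeasure (cut n y) (A n)
        \<le> (\<integral>\<^sup>+\<theta>. ennreal \<bar>\<pi>1 n y \<theta> - \<phi> n y \<theta>\<bar> \<partial>\<mu>)
          + (\<integral>\<^sup>+\<theta>. ennreal \<bar>\<pi>1 n y \<theta> - \<phi>' n y \<theta>\<bar> \<partial>\<mu>) + J n y"
      if n: "n \<ge> 1" and y: "y \<in> space (M n)" and \<psi>: "\<psi> n y = 0"
        and dn: "mpost1 n y = density \<mu> (\<lambda>\<theta>. ennreal (\<pi>1 n y \<theta>))" for n y
    proof -
      note [measurable] = h_meas[OF n] \<phi>'(1)[OF n] \<phi>(1)[OF n] T[OF n] T'[OF n]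
        dens_meas[rule_format, OF n]
      have \<kappa>: "(\<lambda>\<theta>. post2 n \<theta> y) \<in> \<Theta> \<rightarrow>\<^sub>M prob_algebra F2"
        using measurable_compose[OF measurable_Pair2'[OF y] post2_meas[rule_format, OF n]] by simp
      have "emeasure (cut n y) (A n)
          = (\<integral>\<^sup>+\<theta>. emeasure (post2 n \<theta> y) (Pair \<theta> -` A n) \<partial>mpost1 n y)"
        unfolding cut_eq using truth sp\<Theta>
        by (intro emeasure_cut_joint \<kappa> A[OF n]) (auto simp: mpost1_eq)
      \<comment> \<open>Acceptance puts \<open>y\<close> into \<open>B n\<close>, so the indicator
        in \<open>h\<close> equals 1.\<close>
      also have "\<dots> = (\<integral>\<^sup>+\<theta>. h n y \<theta> \<partial>density \<mu> (\<lambda>\<theta>. ennreal (\<pi>1 n y \<theta>)))"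
        unfolding dn using y \<psi> by (simp add: h_def B_def)
      also have "\<dots> \<le> (\<integral>\<^sup>+\<theta>. ennreal \<bar>\<pi>1 n y \<theta> - \<phi> n y \<theta>\<bar> \<partial>\<mu>)
          + (\<integral>\<^sup>+\<theta>. ennreal \<bar>\<pi>1 n y \<theta> - \<phi>' n y \<theta>\<bar> \<partial>\<mu>) + J n y"
        unfolding J_def using y \<phi>(2)[OF n y] \<phi>'(2,3)[OF n y] h_le[OF n y] sp\<mu>
        by (intro nn_integral_density_le_approx) auto
      finally show ?thesis .
    qed

    \<comment> \<open>Passage to convergence in probability\<close>
    show ?thesis
      unfolding small_op_def
    proof (intro allI impI)
      fix \<delta> :: real assume \<delta>: "\<delta> > 0"
      let ?\<Delta> = "\<lambda>n y. \<integral>\<^sup>+\<theta>. ennreal \<bar>\<pi>1 n y \<theta> - \<phi> n y \<theta>\<bar> \<partial>\<mu>"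
      let ?\<Delta>' = "\<lambda>n y. \<integral>\<^sup>+\<theta>. ennreal \<bar>\<pi>1 n y \<theta> - \<phi>' n y \<theta>\<bar> \<partial>\<mu>"
      let ?dens = "\<lambda>n y. mpost1 n y = density \<mu> (\<lambda>\<theta>. ennreal (\<pi>1 n y \<theta>))"
      \<comment> \<open>Five exceptional events are removed: failure of the density formula (null),
        rejection by the test, and excess over \<open>\<delta> / 3\<close> of each of the three
        terms in \<open>cut_le\<close>. The threshold \<open>1 / 2\<close> separates the two values
        of \<open>\<psi> n\<close>.\<close>
      have "prob_vanishes Q (\<lambda>n y. \<not> ?dens n y)"
      proof (rule prob_vanishes_AE)
        show "\<forall>\<^sub>F n in sequentially. AE y in Q n. \<not> \<not> ?dens n y"
          using eventually_ge_at_top[of 1] by eventually_elim (use dens in simp)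
      qed
      moreover have "prob_vanishes Q (\<lambda>n y. ennreal (\<psi> n y) > ennreal (1 / 2))"
        using \<psi>_op unfolding small_op_def by (elim allE[of _ "1 / 2"]) simp
      moreover have "prob_vanishes Q (\<lambda>n y. ?\<Delta> n y > ennreal (\<delta> / 3))"
        "prob_vanishes Q (\<lambda>n y. ?\<Delta>' n y > ennreal (\<delta> / 3))"
        "prob_vanishes Q (\<lambda>n y. J n y > ennreal (\<delta> / 3))"
        using D D' J_op \<delta> unfolding small_op_def by simp_all
      ultimately have "prob_vanishes Q (\<lambda>n y. \<not> ?dens n y \<or> ennreal (\<psi> n y) > ennreal (1 / 2)
          \<or> ?\<Delta> n y > ennreal (\<delta> / 3) \<or> ?\<Delta>' n y > ennreal (\<delta> / 3) \<or> J n y > ennreal (\<delta> / 3))"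
        by (intro prob_vanishes_disj)
      then show "prob_vanishes Q (\<lambda>n y. emeasure (cut n y) (A n) > ennreal \<delta>)"
      proof (rule prob_vanishes_mono)
        show "\<forall>\<^sub>F n in sequentially. \<forall>y\<in>space (Q n). ennreal \<delta> < emeasure (cut n y) (A n) \<longrightarrow>
            \<not> ?dens n y \<or> ennreal (\<psi> n y) > ennreal (1 / 2)
            \<or> ?\<Delta> n y > ennreal (\<delta> / 3) \<or> ?\<Delta>' n y > ennreal (\<delta> / 3) \<or> J n y > ennreal (\<delta> / 3)"
          using eventually_ge_at_top[of 1]
        proof eventually_elim
          case (elim n)
          show ?case
          proof (intro ballI impI, rule ccontr)
            fix y assume y: "y \<in> space (Q n)" and gt: "ennreal \<delta> < emeasure (cut n y) (A n)"
              and "\<not> (\<not> ?dens n y \<or> ennreal (\<psi> n y) > ennreal (1 / 2)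
                \<or> ?\<Delta> n y > ennreal (\<delta> / 3) \<or> ?\<Delta>' n y > ennreal (\<delta> / 3) \<or> J n y > ennreal (\<delta> / 3))"
            then have dn: "?dens n y" and \<psi>le: "ennreal (\<psi> n y) \<le> ennreal (1 / 2)"
              and le: "?\<Delta> n y \<le> ennreal (\<delta> / 3)" "?\<Delta>' n y \<le> ennreal (\<delta> / 3)" "J n y \<le> ennreal (\<delta> / 3)"
              by (simp_all add: not_less)
            have yM: "y \<in> space (M n)" using y Q'(3)[OF elim] by simp
            have "\<psi> n y \<le> 1 / 2" using \<psi>le by (subst (asm) ennreal_le_iff) simp_all
            then have "\<psi> n y = 0" using psi(2)[rule_format, OF elim yM] by auto
            from cut_le[OF elim yM this dn] le
            have "emeasure (cut n y) (A n) \<le> ennreal (\<delta> / 3) + ennreal (\<delta> / 3) + ennreal (\<delta> / 3)"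
              by (meson add_mono order_trans)
            also have "\<dots> = ennreal \<delta>" using \<delta> by (simp flip: ennreal_plus)
            finally show False using gt by simp
          qed
        qed
      qed
    qed
  qed

  \<comment> \<open>Application to the strict loss set and to the complement of the open
    ball\<close>
  let ?d = "\<lambda>(\<theta>, \<eta>). d (P l \<theta> \<eta>) (P l \<theta>0 \<eta>0)"
  have sp: "space (\<Theta> \<Otimes>\<^sub>M F2) = \<T> \<times> space F2" by (simp add: space_pair_measure sp\<Theta>)
  note [measurable] = loss_meas
  have SUP_le: "(\<integral>\<^sup>+y. ennreal (1 - \<psi> n y) \<partial>P n \<theta> \<eta>) \<le> u"
    if "(SUP (\<theta>, \<eta>)\<in>X. \<integral>\<^sup>+y. ennreal (1 - \<psi> n y) \<partial>P n \<theta> \<eta>) \<le> u" "(\<theta>, \<eta>) \<in> X"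
    for n \<theta> \<eta> u and X :: "('a \<times> 'e) set"
    using that by (auto simp: SUP_le_iff)
  have "small_op Q (\<lambda>n y. emeasure (cut n y) {(\<theta>, \<eta>) \<in> \<T> \<times> space F2. ?d (\<theta>, \<eta>) > ennreal (K n * \<epsilon> n)})"
  proof (rule main)
    fix n
    have "{x \<in> space (\<Theta> \<Otimes>\<^sub>M F2). ?d x > ennreal (K n * \<epsilon> n)} \<in> sets (\<Theta> \<Otimes>\<^sub>M F2)" by measurable
    also have "{x \<in> space (\<Theta> \<Otimes>\<^sub>M F2). ?d x > ennreal (K n * \<epsilon> n)}
        = {(\<theta>, \<eta>) \<in> \<T> \<times> space F2. ?d (\<theta>, \<eta>) > ennreal (K n * \<epsilon> n)}"
      by (auto simp: sp)
    finally show "{(\<theta>, \<eta>) \<in> \<T> \<times> space F2. ?d (\<theta>, \<eta>) > ennreal (K n * \<epsilon> n)} \<in> sets (\<Theta> \<Otimes>\<^sub>M F2)" .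
  qed (rule SUP_le[OF psi_alt[rule_format]]; auto)
  moreover have "small_op Q (\<lambda>n y. emeasure (cut n y) (\<T> \<times> space F2 - loss_ball d (P l) \<theta>0 \<eta>0 (K n * \<epsilon> n)))"
    if eq: "\<forall>n\<ge>1. (SUP (\<theta>, \<eta>) \<in> {(\<theta>, \<eta>) \<in> Sigma (T n) (F2n n).
                              d (P l \<theta> \<eta>) (P l \<theta>0 \<eta>0) = ennreal (K n * \<epsilon> n)}.
               \<integral>\<^sup>+y. ennreal (1 - \<psi> n y) \<partial>P n \<theta> \<eta>)
              \<le> ennreal (C' * exp (- 2 * L n * real n * (\<epsilon> n)\<^sup>2))"
  proof (rule main)
    fix n
    have "{x \<in> space (\<Theta> \<Otimes>\<^sub>M F2). \<not> ?d x < ennreal (K n * \<epsilon> n)} \<in> sets (\<Theta> \<Otimes>\<^sub>M F2)" by measurable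
    also have "{x \<in> space (\<Theta> \<Otimes>\<^sub>M F2). \<not> ?d x < ennreal (K n * \<epsilon> n)}
        = \<T> \<times> space F2 - loss_ball d (P l) \<theta>0 \<eta>0 (K n * \<epsilon> n)"
      by (auto simp: sp loss_ball_def)
    finally show "\<T> \<times> space F2 - loss_ball d (P l) \<theta>0 \<eta>0 (K n * \<epsilon> n) \<in> sets (\<Theta> \<Otimes>\<^sub>M F2)" .
  next
    fix n \<theta> \<eta>
    assume n: "n \<ge> 1" and \<theta>: "\<theta> \<in> T n" "\<eta> \<in> F2n n \<theta>"
      and "(\<theta>, \<eta>) \<in> \<T> \<times> space F2 - loss_ball d (P l) \<theta>0 \<eta>0 (K n * \<epsilon> n)"
    \<comment> \<open>Strict excess is covered by \<open>psi_alt\<close>; the boundary case is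
      covered by the premise \<open>eq\<close> of the second conjunct.\<close>
    then have "?d (\<theta>, \<eta>) > ennreal (K n * \<epsilon> n) \<or> ?d (\<theta>, \<eta>) = ennreal (K n * \<epsilon> n)"
      by (auto simp: loss_ball_def)
    then show "(\<integral>\<^sup>+y. ennreal (1 - \<psi> n y) \<partial>P n \<theta> \<eta>) \<le> ennreal (C' * exp (- 2 * L n * real n * (\<epsilon> n)\<^sup>2))"
      using \<theta> by (elim disjE; intro SUP_le[OF psi_alt[rule_format, OF n]] SUP_le[OF eq[rule_format, OF n]]) auto
  qed
  ultimately show ?thesis unfolding Q_def by simp
qed

end
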